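(* Let $R$ be a ring and $I$ a (two-sided) ideal in $R$. Then every element of the quotient ring $R/I$ (that is, every coset $r+I\subseteq R$, $r\in R$) is a paragon in the associated truss $\mathrm{T}(R)$.
   Context: For a ring $R$, the associated truss $\mathrm{T}(R)$ is the set $R$ with the ternary operation $[a,b,c]=a-b+c$ and the multiplication of $R$. A sub-heap is a subset closed under $[-,-,-]$. A paragon in $\mathrm{T}(R)$ is a sub-heap $P\subseteq R$ for which there exists $q\in P$ such that, for all $x\in R$ and $p\in P$, $[xp,xq,q]\in P$ and $[px,qx,q]\in P$. *)

theory Defs
  imports "HOL-Algebra.QuotRing"
begin

section \<open>Rings that need not be unital\<close>

text \<open>
  The locale \<^locale>\<open>ring\<close> of the library demands a multiplicative identity. Rings are taken here
  to be associative but not necessarily unital. They are carried by the same record type, whose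
  field \<^term>\<open>one\<close> is then without meaning. In the unital case the notions below agree with those
  of the library; see the lemmas that follow them.
\<close>

locale rng = abelian_group R for R (structure) +
  assumes rng_m_closed: "\<lbrakk> x \<in> carrier R; y \<in> carrier R \<rbrakk> \<Longrightarrow> x \<otimes> y \<in> carrier R"
    and rng_m_assoc: "\<lbrakk> x \<in> carrier R; y \<in> carrier R; z \<in> carrier R \<rbrakk>
      \<Longrightarrow> (x \<otimes> y) \<otimes> z = x \<otimes> (y \<otimes> z)"
    and rng_l_distr: "\<lbrakk> x \<in> carrier R; y \<in> carrier R; z \<in> carrier R \<rbrakk>
      \<Longrightarrow> (x \<oplus> y) \<otimes> z = x \<otimes> z \<oplus> y \<otimes> z"
    and rng_r_distr: "\<lbrakk> x \<in> carrier R; y \<in> carrier R; z \<in> carrier R \<rbrakk>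
      \<Longrightarrow> z \<otimes> (x \<oplus> y) = z \<otimes> x \<oplus> z \<otimes> y"

locale rng_ideal = additive_subgroup I R + rng R for I and R (structure) +
  assumes rng_I_l_closed: "\<lbrakk> a \<in> I; x \<in> carrier R \<rbrakk> \<Longrightarrow> x \<otimes> a \<in> I"
    and rng_I_r_closed: "\<lbrakk> a \<in> I; x \<in> carrier R \<rbrakk> \<Longrightarrow> a \<otimes> x \<in> I"

lemma ring_iff_rng_monoid: "ring R \<longleftrightarrow> rng R \<and> monoid R"
proof
  assume "ring R"
  then interpret ring R .
  have "rng R"
    by (unfold_locales; fact m_closed m_assoc l_distr r_distr)
  then show "rng R \<and> monoid R"
    using monoid_axioms by blast
next
  assume "rng R \<and> monoid R"
  then interpret rng R + monoid R by simp_all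
  show "ring R"
    by (unfold_locales; fact rng_l_distr rng_r_distr)
qed

lemma (in ring) ideal_iff_rng_ideal: "ideal I R \<longleftrightarrow> rng_ideal I R"
  using ring_axioms ring_iff_rng_monoid[of R]
  unfolding ideal_def ideal_axioms_def rng_ideal_def rng_ideal_axioms_def by blast

text \<open>
  The definition of \<^const>\<open>FactRing\<close> does not refer to a locale, so it also applies in the
  non-unital case (apart from its field \<^term>\<open>one\<close>): its carrier consists of the cosets of the ideal.
\<close>

lemma (in rng) carrier_Quot:
  assumes "I \<subseteq> carrier R"
  shows "carrier (R Quot I) = {r <+ I | r. r \<in> carrier R}"
proof -
  have "I +> r = r <+ I" if "r \<in> carrier R" for r
    unfolding a_r_coset_def' a_l_coset_def'
    using assms that by (intro SUP_cong refl) (auto intro: a_comm)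
  then show ?thesis
    unfolding FactRing_simps by auto
qed


section \<open>Trusses, sub-heaps and paragons\<close>

record 'a truss = "'a partial_object" +
  heap_op :: "'a \<Rightarrow> 'a \<Rightarrow> 'a \<Rightarrow> 'a"
  truss_mult :: "'a \<Rightarrow> 'a \<Rightarrow> 'a"

definition assoc_truss :: "('a, 'b) ring_scheme \<Rightarrow> 'a truss" where
  "assoc_truss R =
    \<lparr>carrier = carrier R,
     heap_op = (\<lambda>a b c. (a \<ominus>\<^bsub>R\<^esub> b) \<oplus>\<^bsub>R\<^esub> c),
     truss_mult = (\<lambda>a b. a \<otimes>\<^bsub>R\<^esub> b)\<rparr>"

definition sub_heap :: "('a, 'b) truss_scheme \<Rightarrow> 'a set \<Rightarrow> bool" where
  "sub_heap T P \<longleftrightarrow>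
    P \<subseteq> carrier T \<and> (\<forall>a\<in>P. \<forall>b\<in>P. \<forall>c\<in>P. heap_op T a b c \<in> P)"

definition paragon :: "('a, 'b) truss_scheme \<Rightarrow> 'a set \<Rightarrow> bool" where
  "paragon T P \<longleftrightarrow>
    sub_heap T P \<and>
    (\<exists>q\<in>P. \<forall>x\<in>carrier T. \<forall>p\<in>P.
      heap_op T (truss_mult T x p) (truss_mult T x q) q \<in> P \<and>
      heap_op T (truss_mult T p x) (truss_mult T q x) q \<in> P)"

end

theory Submission
  imports Defs
begin

text \<open>In a coset \<open>r <+ I\<close> the representative \<open>r\<close> can itself serve as
  the element \<open>q\<close> of the paragon condition. If p = r + i with i in I, distributivity
  gives xp - xr + r = r + xi and px - rx + r = r + ix, and both stay in the coset because I absorbs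
  products on either side. Closure under the heap operation uses addition alone
  (\<open>a_l_coset_heap_closed\<close>); \<open>a_l_coset_paragon\<close> adds the multiplicative
  part.\<close>

lemma (in abelian_group) add_add_neg_cancel:
  "\<lbrakk> x \<in> carrier G; y \<in> carrier G \<rbrakk> \<Longrightarrow> x \<oplus> (y \<oplus> \<ominus> x) = y"
  by (metis a_comm a_inv_closed r_neg2)

text \<open>In [a,b,c] the coefficients 1, -1, 1 sum to 1, so exactly one \<open>r\<close> survives,
  and the remainders combine to i - j + k, which lies in the subgroup.\<close>

lemma (in abelian_group) a_l_coset_heap_closed:
  assumes "additive_subgroup I G" "r \<in> carrier G"
    and "a \<in> r <+ I" "b \<in> r <+ I" "c \<in> r <+ I"
  shows "(a \<ominus> b) \<oplus> c \<in> r <+ I"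
proof -
  interpret I: additive_subgroup I G by fact
  obtain i j k where ijk: "i \<in> I" "j \<in> I" "k \<in> I"
    and abc: "a = r \<oplus> i" "b = r \<oplus> j" "c = r \<oplus> k"
    using assms(3-5) unfolding a_l_coset_def' by blast
  have carr: "i \<in> carrier G" "j \<in> carrier G" "k \<in> carrier G"
    using ijk I.a_subset by auto
  have "(a \<ominus> b) \<oplus> c = r \<oplus> (i \<oplus> (\<ominus> j \<oplus> k))"
    unfolding abc using carr assms(2)
    by (simp add: minus_eq minus_add a_ac add_add_neg_cancel)
  moreover have "i \<oplus> (\<ominus> j \<oplus> k) \<in> I"
    using ijk by (intro I.a_closed I.a_inv_closed)
  ultimately show ?thesis
    unfolding a_l_coset_def' by blast
qed

lemma (in rng_ideal) a_l_coset_paragon: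
  assumes r: "r \<in> carrier R"
  shows "paragon (assoc_truss R) (r <+ I)"
proof -
  \<comment> \<open>Covers both paragon conditions: \<open>a\<close> will be
    \<open>x \<otimes> r\<close> or \<open>r \<otimes> x\<close>, and \<open>i\<close> the matching
    multiple of an ideal element.\<close>
  have cancel: "(a \<oplus> i \<ominus> a) \<oplus> r \<in> r <+ I" if "a \<in> carrier R" "i \<in> I" for a i
  proof -
    have "(a \<oplus> i \<ominus> a) \<oplus> r = r \<oplus> i"
      using that(1) a_Hcarr[OF that(2)] r by (simp add: minus_eq a_comm r_neg1)
    then show ?thesis
      using that unfolding a_l_coset_def' by blast
  qed
  have "r <+ I \<subseteq> carrier R"
    using r a_subset unfolding a_l_coset_def' by auto
  then have "sub_heap (assoc_truss R) (r <+ I)"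
    using a_l_coset_heap_closed[OF additive_subgroup_axioms r]
    by (simp add: sub_heap_def assoc_truss_def)
  moreover have "r \<in> r <+ I"
    using r zero_closed unfolding a_l_coset_def' by force
  moreover have "(x \<otimes> p \<ominus> x \<otimes> r) \<oplus> r \<in> r <+ I \<and> (p \<otimes> x \<ominus> r \<otimes> x) \<oplus> r \<in> r <+ I"
    if x: "x \<in> carrier R" and p: "p \<in> r <+ I" for x p
  proof -
    obtain i where i: "i \<in> I" "p = r \<oplus> i"
      using p unfolding a_l_coset_def' by blast
    \<comment> \<open>Splitting off the product with \<open>r\<close> brings both expressions into
      the form treated by \<open>cancel\<close>.\<close>
    have "x \<otimes> p = x \<otimes> r \<oplus> x \<otimes> i" "p \<otimes> x = r \<otimes> x \<oplus> i \<otimes> x"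
      using i x r a_subset by (auto simp: rng_l_distr rng_r_distr)
    then show ?thesis
      using i x r by (simp add: cancel rng_m_closed rng_I_l_closed rng_I_r_closed)
  qed
  ultimately show ?thesis
    unfolding paragon_def by (auto simp: assoc_truss_def intro!: bexI[of _ r])
qed

theorem corollary3p3:
  fixes R :: "('a, 'b) ring_scheme" and I :: "'a set"
  assumes "rng R"
    and "rng_ideal I R"
  shows "\<forall>P \<in> carrier (R Quot I). paragon (assoc_truss R) P"
proof -
  interpret rng_ideal I R by fact
  show ?thesis
    \<comment> \<open>The quotient is built from right cosets; \<open>carrier_Quot\<close> presents
      them as left cosets \<open>r <+ I\<close>.\<close>
    using a_l_coset_paragon carrier_Quot[OF a_subset] by auto
qed

end
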